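(* Let $\sigma_0^2>0$. For any $\delta>0$ and any integer $n\ge1$ there is a unique $\rho_n>0$ solving $$\frac n2\big(\rho_n-\ln(1+\rho_n)\big)=\delta,$$ and the uniform choice of per-use covert variance $P_t\equiv P_n=\sigma_0^2\rho_n$ meets the covertness constraint with equality: $$D\big(P_{R_1^n\mid S=s}\,\big\|\,P_{R_0^n\mid S=s}\big)=\delta\qquad\text{for every admissible } s\in\mathcal S_{\mathrm{adm}},$$ where, conditioned on $S=s$, $R_0^n\sim\mathcal N(0,\sigma_0^2I_n)$ and $R_1^n\sim\mathcal N(0,(\sigma_0^2+P_n)I_n)$. Moreover, for fixed $\delta$, as $n\to\infty$, $\rho_n=2\sqrt{\delta/n}+O(\delta/n)$.
   Context: All logarithms are natural; $D$ is relative entropy, $D(P\|Q)=\int\log\frac{dP}{dQ}\,dP$. $S$ is the warden's side information with set of admissible values $\mathcal S_{\mathrm{adm}}$; $R_0^n$ and $R_1^n$ are the warden's length-$n$ residual vectors without and with covert transmission. In the stationary case with i.i.d. Gaussian covert symbols $X_{c,t}\sim\mathcal N(0,P_n)$ independent of the null residual, their laws conditioned on $S=s$ are the product Gaussian laws given in the claim, for every admissible $s$. The covertness constraint is $D(P_{R_1^n\mid S=s}\|P_{R_0^n\mid S=s})\le\delta$ for all $s\in\mathcal S_{\mathrm{adm}}$. *)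

theory Defs
  imports "HOL-Probability.Probability" "HOL-Library.Landau_Symbols"
begin

text \<open>
  D(P || Q) in nats. The library's \<^const>\<open>KL_divergence\<close> takes the reference measure first:
  KL_divergence b Q P is the integral of log b (dP/dQ) with respect to P. It evaluates to 0 if
  P has no density with respect to Q or if the integral does not exist, so a strictly positive
  value is a genuine one.
\<close>
definition relative_entropy :: "'a measure \<Rightarrow> 'a measure \<Rightarrow> real" where
  "relative_entropy P Q = KL_divergence (exp 1) Q P"

text \<open>
  Vectors of length n are extensional functions on {..<n}, so that n can vary within a statement.
\<close>
abbreviation vec_borel :: "nat \<Rightarrow> (nat \<Rightarrow> real) measure" where
  "vec_borel n \<equiv> (\<Pi>\<^sub>M t\<in>{..<n}. borel)"

text \<open>
  N(0, v I) in dimension n, for a variance v > 0; \<^const>\<open>normal_density\<close> takes the standard deviation.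
\<close>
definition gaussian_vec :: "nat \<Rightarrow> real \<Rightarrow> (nat \<Rightarrow> real) measure" where
  "gaussian_vec n v = (\<Pi>\<^sub>M t\<in>{..<n}. density lborel (\<lambda>x. ennreal (normal_density 0 (sqrt v) x)))"

text \<open>
  K is a regular conditional distribution of R given S, i.e. K s is the law of R given S = s.
  Such a K is determined only up to a null set of values s; values at individual points s are
  those of the chosen version.
\<close>
definition cond_law ::
  "'w measure \<Rightarrow> 's measure \<Rightarrow> ('w \<Rightarrow> 's) \<Rightarrow> 'r measure \<Rightarrow> ('w \<Rightarrow> 'r) \<Rightarrow> ('s \<Rightarrow> 'r measure) \<Rightarrow> bool"
where
  "cond_law \<Omega> MSide S MRes R K \<longleftrightarrow>
     S \<in> measurable \<Omega> MSide \<and> R \<in> measurable \<Omega> MRes \<and> K \<in> measurable MSide (prob_algebra MRes) \<and>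
     (\<forall>A\<in>sets MSide. \<forall>B\<in>sets MRes.
        emeasure \<Omega> {\<omega> \<in> space \<Omega>. S \<omega> \<in> A \<and> R \<omega> \<in> B}
          = (\<integral>\<^sup>+ s\<in>A. emeasure (K s) B \<partial>distr \<Omega> MSide S))"

end

theory Submission imports Defs begin

text \<open>
  The density of N(0, w I) with respect to N(0, v I) is a product of one-dimensional ratios, so the
  relative entropy is n times that of the coordinates, which by the second moment of a Gaussian is
  (w/v - 1 - ln (w/v)) / 2. With w/v = 1 + \<rho> this is the left-hand side of the equation for \<rho>.
  For the asymptotics, put a = \<rho> - ln (1 + \<rho>) = 2\<delta>/n; then
  \<rho>^2 / (2 (1 + \<rho>)) \<le> a \<le> \<rho>^2 / 2, and solving the two quadratic inequalities for \<rho> gives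
  0 \<le> \<rho> - sqrt (2a) \<le> 2a for every n, where sqrt (2a) = 2 sqrt (\<delta>/n).
\<close>

section \<open>The function x - ln (1 + x)\<close>

text \<open>Right side minus left side vanishes at 0 and has derivative
  \<open>t\<^sup>2 / (1 + t)\<close>. This bound places the root at or above
  \<open>sqrt (2 * a)\<close>.\<close>

lemma diff_ln_le_half_square:
  fixes x :: real
  assumes "0 \<le> x"
  shows "x - ln (1 + x) \<le> x\<^sup>2 / 2"
proof -
  have "(\<lambda>t. t\<^sup>2 / 2 - t + ln (1 + t)) 0 \<le> (\<lambda>t. t\<^sup>2 / 2 - t + ln (1 + t)) x"
  proof (rule DERIV_nonneg_imp_nondecreasing[OF assms])
    fix t :: real assume t: "0 \<le> t" "t \<le> x"
    have "((\<lambda>t. t\<^sup>2 / 2 - t + ln (1 + t)) has_real_derivative t\<^sup>2 / (1 + t)) (at t)"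
      using t by (auto intro!: derivative_eq_intros simp: field_simps power2_eq_square)
    then show "\<exists>y. ((\<lambda>t. t\<^sup>2 / 2 - t + ln (1 + t)) has_real_derivative y) (at t) \<and> 0 \<le> y"
      using t by auto
  qed
  then show ?thesis by simp
qed

text \<open>With u = 1 + x this is ln u \<le> (u - 1/u) / 2, an equality at u = 1. The derivative of
  the gap is (1 - 1/u)^2 / 2, a perfect square. The bound also forces growth without limit, which
  existence of the root needs.\<close>

lemma diff_ln_ge:
  fixes x :: real
  assumes "0 \<le> x"
  shows "x\<^sup>2 / (2 * (1 + x)) \<le> x - ln (1 + x)"
proof -
  let ?g = "\<lambda>t::real. (1 + t) / 2 - 1 / (2 * (1 + t)) - ln (1 + t)"
  have "?g 0 \<le> ?g x"
  proof (rule DERIV_nonneg_imp_nondecreasing[OF assms])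
    fix t :: real assume t: "0 \<le> t" "t \<le> x"
    have "(?g has_real_derivative t\<^sup>2 / (2 * (1 + t)\<^sup>2)) (at t)"
      using t
      by (auto intro!: derivative_eq_intros)
         (simp add: divide_simps power2_eq_square, simp add: algebra_simps)
    then show "\<exists>y. (?g has_real_derivative y) (at t) \<and> 0 \<le> y"
      by (meson divide_nonneg_nonneg mult_nonneg_nonneg zero_le_numeral zero_le_power2)
  qed
  moreover have "(1 + x) / 2 - 1 / (2 * (1 + x)) = x - x\<^sup>2 / (2 * (1 + x))"
    using assms by (simp add: divide_simps power2_eq_square) (simp add: algebra_simps)
  ultimately show ?thesis by simp
qed

text \<open>The quotient of 1 + y by 1 + x is 1 + u with u = (y - x) / (1 + x) > 0, and ln (1 + u) <
  u \<le> y - x.\<close>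

lemma diff_ln_strict_mono:
  fixes x y :: real
  assumes "0 \<le> x" "x < y"
  shows "x - ln (1 + x) < y - ln (1 + y)"
proof -
  have "ln (1 + y) - ln (1 + x) = ln ((1 + y) / (1 + x))"
    using assms by (simp add: ln_div)
  also have "\<dots> = ln (1 + (y - x) / (1 + x))"
    using assms by (simp add: field_simps)
  also have "\<dots> < (y - x) / (1 + x)"
    using assms by (intro ln_add_one_self_less_self) simp
  also have "\<dots> \<le> y - x"
    using assms by (simp add: divide_simps mult_left_mono)
  finally show ?thesis by simp
qed

lemma ex1_diff_ln_eq:
  fixes a :: real
  assumes "0 < a"
  shows "\<exists>!x. 0 < x \<and> x - ln (1 + x) = a"
proof (rule ex_ex1I)
  \<comment> \<open>An upper end for the intermediate value theorem: 2a(1 + b) = 4a^2 + 6a lies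
    below b^2 = 4a^2 + 8a + 4, so the lower bound from \<open>diff_ln_ge\<close> already exceeds
    \<open>a\<close> at \<open>b\<close>.\<close>
  define b where "b = 2 * a + 2"
  have "a * (2 * (1 + b)) \<le> b\<^sup>2"
    using assms unfolding b_def by (simp add: power2_eq_square algebra_simps)
  then have "a \<le> b\<^sup>2 / (2 * (1 + b))"
    using assms unfolding b_def by (simp add: pos_le_divide_eq)
  then have "a \<le> b - ln (1 + b)"
    using diff_ln_ge[of b] assms by (simp add: b_def)
  moreover have "continuous_on {0..b} (\<lambda>x. x - ln (1 + x))"
    by (auto intro!: continuous_intros)
  ultimately obtain x where "0 \<le> x" "x \<le> b" "x - ln (1 + x) = a"
    using IVT'[of "\<lambda>x. x - ln (1 + x)" 0 a b] assms by (auto simp: b_def)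
  moreover from this assms have "x \<noteq> 0" by auto
  ultimately show "\<exists>x. 0 < x \<and> x - ln (1 + x) = a" by (intro exI[of _ x]) auto
next
  fix x y assume *: "0 < x \<and> x - ln (1 + x) = a" "0 < y \<and> y - ln (1 + y) = a"
  then show "x = y"
    using diff_ln_strict_mono[of x y] diff_ln_strict_mono[of y x]
    by (cases x y rule: linorder_cases) auto
qed

lemma diff_ln_solution_bounds:
  fixes x :: real
  assumes "0 \<le> x"
  defines "a \<equiv> x - ln (1 + x)"
  shows "sqrt (2 * a) \<le> x" "x \<le> sqrt (2 * a) + 2 * a"
proof -
  have a: "a \<le> x\<^sup>2 / 2" "x\<^sup>2 / (2 * (1 + x)) \<le> a"
    using diff_ln_le_half_square diff_ln_ge assms by (auto simp: a_def)
  have "0 \<le> x\<^sup>2 / (2 * (1 + x))" using assms by simp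
  then have "0 \<le> a" using a by linarith
  show "sqrt (2 * a) \<le> x"
    using a assms by (intro real_le_lsqrt) auto
  have "x\<^sup>2 \<le> a * (2 * (1 + x))"
    using a(2) assms by (simp add: pos_divide_le_eq)
  \<comment> \<open>Completing the square in x^2 - 2ax - 2a \<le> 0. The next bound adds the
    nonnegative cross term 2a sqrt (2a), so that the root can be taken without nesting.\<close>
  then have "(x - a)\<^sup>2 \<le> a\<^sup>2 + 2 * a"
    by (simp add: power2_eq_square algebra_simps)
  also have "\<dots> \<le> (a + sqrt (2 * a))\<^sup>2"
    using \<open>0 \<le> a\<close> by (simp add: power2_sum)
  finally have "x - a \<le> a + sqrt (2 * a)"
    by (rule power2_le_imp_le) (use \<open>0 \<le> a\<close> in simp)
  then show "x \<le> sqrt (2 * a) + 2 * a" by simp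
qed

section \<open>Relative entropy of product measures\<close>

text \<open>A product measure is determined by its values on boxes. There the indicator is a product
  of coordinate indicators, so the integral factorises.\<close>

lemma PiM_density:
  assumes "finite I" "\<And>i. sigma_finite_measure (M i)"
    and f [measurable]: "\<And>i. i \<in> I \<Longrightarrow> f i \<in> borel_measurable (M i)"
    and "\<And>i. sigma_finite_measure (density (M i) (f i))"
  shows "PiM I (\<lambda>i. density (M i) (f i)) = density (PiM I M) (\<lambda>x. \<Prod>i\<in>I. f i (x i))"
proof -
  interpret M: product_sigma_finite M by (rule product_sigma_finite.intro, rule assms)
  interpret D: product_sigma_finite "\<lambda>i. density (M i) (f i)" by (rule product_sigma_finite.intro, rule assms)
  have [measurable]: "(\<lambda>x. \<Prod>i\<in>I. f i (x i)) \<in> borel_measurable (PiM I M)"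
    by measurable
  have sets: "sets (PiM I (\<lambda>i. density (M i) (f i))) = sets (PiM I M)"
    by (rule sets_PiM_cong) auto
  show ?thesis
  proof (rule D.PiM_eqI[symmetric, OF assms(1)])
    show "sets (density (PiM I M) (\<lambda>x. \<Prod>i\<in>I. f i (x i))) = sets (PiM I (\<lambda>i. density (M i) (f i)))"
      by (simp add: sets)
    fix A assume A: "\<And>i. i \<in> I \<Longrightarrow> A i \<in> sets (density (M i) (f i))"
    then have A': "\<And>i. i \<in> I \<Longrightarrow> A i \<in> sets (M i)" by simp
    have "emeasure (density (PiM I M) (\<lambda>x. \<Prod>i\<in>I. f i (x i))) (Pi\<^sub>E I A)
        = (\<integral>\<^sup>+x. (\<Prod>i\<in>I. f i (x i)) * indicator (Pi\<^sub>E I A) x \<partial>PiM I M)"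
      using assms(1) A' by (intro emeasure_density) auto
    also have "\<dots> = (\<integral>\<^sup>+x. (\<Prod>i\<in>I. f i (x i) * indicator (A i) (x i)) \<partial>PiM I M)"
    proof (rule nn_integral_cong)
      fix x assume "x \<in> space (PiM I M)"
      \<comment> \<open>Points of the product space are extensional, so lying in the box depends
        only on the coordinates in \<open>I\<close>.\<close>
      then have "indicator (Pi\<^sub>E I A) x = (\<Prod>i\<in>I. indicator (A i) (x i) :: ennreal)"
        using assms(1)
        by (auto simp: indicator_def space_PiM PiE_iff prod_zero_iff intro: extensional_arb)
      then show "(\<Prod>i\<in>I. f i (x i)) * indicator (Pi\<^sub>E I A) x
          = (\<Prod>i\<in>I. f i (x i) * indicator (A i) (x i))"
        by (simp add: prod.distrib)
    qed
    also have "\<dots> = (\<Prod>i\<in>I. \<integral>\<^sup>+x. f i x * indicator (A i) x \<partial>M i)"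
      using A' by (intro M.product_nn_integral_prod assms(1) borel_measurable_times_ennreal
        borel_measurable_indicator f)
    also have "\<dots> = (\<Prod>i\<in>I. emeasure (density (M i) (f i)) (A i))"
      using A' by (intro prod.cong refl emeasure_density[symmetric]) auto
    finally show "emeasure (density (PiM I M) (\<lambda>x. \<Prod>i\<in>I. f i (x i))) (Pi\<^sub>E I A)
        = (\<Prod>i\<in>I. emeasure (density (M i) (f i)) (A i))" .
  qed
qed

text \<open>Divergence as the mean log-likelihood ratio under the first law, the form in which the
  logarithm of a product density splits into a sum.\<close>

lemma KL_density_eq_integral:
  assumes "sigma_finite_measure M" "1 < b"
    and f [measurable]: "f \<in> borel_measurable M" and "AE x in M. 0 \<le> f x"
  shows "KL_divergence b M (density M f) = (\<integral>x. log b (f x) \<partial>density M f)"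
  using assms by (simp add: sigma_finite_measure.KL_density integral_density)

text \<open>The logarithm turns the product density into a sum, and each summand depends on one
  coordinate, whose marginal is the corresponding factor.\<close>

lemma KL_divergence_PiM_density:
  fixes f :: "'i \<Rightarrow> 'a \<Rightarrow> real"
  assumes I: "finite I" and b: "1 < b" and M: "\<And>i. sigma_finite_measure (M i)"
    and f: "\<And>i. f i \<in> borel_measurable (M i)" "\<And>i x. 0 < f i x"
    and P: "\<And>i. prob_space (density (M i) (f i))"
    and int: "\<And>i. i \<in> I \<Longrightarrow> integrable (density (M i) (f i)) (\<lambda>x. log b (f i x))"
  shows "KL_divergence b (PiM I M) (PiM I (\<lambda>i. density (M i) (f i)))
    = (\<Sum>i\<in>I. KL_divergence b (M i) (density (M i) (f i)))"
proof -
  note f(1) [measurable]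
  interpret M: product_sigma_finite M by (rule product_sigma_finite.intro, rule M)
  interpret D: product_prob_space "\<lambda>i. density (M i) (f i)" I
    by (intro product_prob_spaceI P)
  let ?P = "PiM I (\<lambda>i. density (M i) (f i))"
  have dens: "?P = density (PiM I M) (\<lambda>x. ennreal (\<Prod>i\<in>I. f i (x i)))"
    using PiM_density[OF I M, of "\<lambda>i x. ennreal (f i x)"] f(2) P
    by (simp add: prod_ennreal less_imp_le prob_space_imp_sigma_finite)
  have component: "distr ?P (density (M i) (f i)) (\<lambda>x. x i) = density (M i) (f i)"
    if "i \<in> I" for i
    using that P by (intro distr_PiM_component I)
  have "KL_divergence b (PiM I M) ?P = (\<integral>x. log b (\<Prod>i\<in>I. f i (x i)) \<partial>?P)"
    unfolding dens using f(2) I b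
    by (intro KL_density_eq_integral M.sigma_finite)
       (auto intro!: AE_I2 prod_nonneg simp: less_imp_le)
  also have "\<dots> = (\<integral>x. (\<Sum>i\<in>I. log b (f i (x i))) \<partial>?P)"
    using I less_imp_neq[OF f(2), symmetric]
    by (simp add: log_def ln_prod sum_divide_distrib[symmetric])
  also have "\<dots> = (\<Sum>i\<in>I. \<integral>x. log b (f i (x i)) \<partial>?P)"
  \<comment> \<open>Exchanging sum and integral requires integrable summands; \<open>int\<close>
    supplies this, carried over to the product through the marginals.\<close>
  proof (rule Bochner_Integration.integral_sum)
    fix i assume i: "i \<in> I"
    show "integrable ?P (\<lambda>x. log b (f i (x i)))"
      by (rule integrable_distr[of "\<lambda>x. x i" ?P "density (M i) (f i)"])
         (use i int in \<open>simp_all add: component\<close>)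
  qed
  also have "\<dots> = (\<Sum>i\<in>I. \<integral>x. log b (f i x) \<partial>density (M i) (f i))"
  proof (rule sum.cong[OF refl])
    fix i assume i: "i \<in> I"
    show "(\<integral>x. log b (f i (x i)) \<partial>?P) = (\<integral>x. log b (f i x) \<partial>density (M i) (f i))"
      using integral_distr[of "\<lambda>x. x i" ?P "density (M i) (f i)" "\<lambda>x. log b (f i x)"] i
      by (simp add: component)
  qed
  also have "\<dots> = (\<Sum>i\<in>I. KL_divergence b (M i) (density (M i) (f i)))"
    using f(2) b M
    by (intro sum.cong refl KL_density_eq_integral[symmetric]) (auto intro: less_imp_le)
  finally show ?thesis .
qed

section \<open>Centred Gaussians\<close>

lemma ln_normal_density_ratio:
  assumes "0 < v" "0 < w"
  shows "ln (normal_density 0 (sqrt w) x / normal_density 0 (sqrt v) x)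
    = (1 / v - 1 / w) / 2 * x\<^sup>2 - ln (w / v) / 2"
proof -
  \<comment> \<open>In the difference of two such logarithms the constant ln (2 pi) / 2
    cancels.\<close>
  have *: "ln (normal_density 0 (sqrt u) x) = - ln (2 * pi) / 2 - ln u / 2 - x\<^sup>2 / (2 * u)"
    if "0 < u" for u
    using that by (simp add: normal_density_def ln_mult ln_div ln_sqrt real_sqrt_mult field_simps)
  have "ln (normal_density 0 (sqrt w) x / normal_density 0 (sqrt v) x)
      = ln (normal_density 0 (sqrt w) x) - ln (normal_density 0 (sqrt v) x)"
    using normal_density_pos[of "sqrt v" 0 x] normal_density_pos[of "sqrt w" 0 x] assms
    by (simp add: ln_div)
  also have "\<dots> = (1 / v - 1 / w) / 2 * x\<^sup>2 - ln (w / v) / 2"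
    unfolding *[OF assms(1)] *[OF assms(2)] using assms by (simp add: ln_div) (simp add: field_simps)
  finally show ?thesis .
qed

lemma
  assumes "0 < v" "0 < w"
  defines "f \<equiv> \<lambda>x. normal_density 0 (sqrt w) x / normal_density 0 (sqrt v) x"
  shows gaussian_density_ratio:
      "density (density lborel (\<lambda>x. ennreal (normal_density 0 (sqrt v) x))) (\<lambda>x. ennreal (f x))
        = density lborel (\<lambda>x. ennreal (normal_density 0 (sqrt w) x))" (is ?dens)
    and integrable_ln_gaussian_ratio:
      "integrable (density lborel (\<lambda>x. ennreal (normal_density 0 (sqrt w) x))) (\<lambda>x. ln (f x))"
      (is ?int)
    and integral_ln_gaussian_ratio:
      "(\<integral>x. ln (f x) \<partial>density lborel (\<lambda>x. ennreal (normal_density 0 (sqrt w) x)))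
        = (w / v - 1 - ln (w / v)) / 2" (is ?val)
proof -
  have [measurable]: "f \<in> borel_measurable borel"
    unfolding f_def by measurable
  show ?dens
    unfolding f_def using assms(1,2)
    by (subst density_density_eq)
       (auto simp: ennreal_mult[symmetric] normal_density_pos less_imp_neq[symmetric])
  \<comment> \<open>The variance, as the even moment of order 2k with k = 1. Since
    \<open>ln (f x)\<close> is affine in x^2, this and total mass 1 determine its mean.\<close>
  have second: "has_bochner_integral lborel (\<lambda>x. normal_density 0 (sqrt w) x * x\<^sup>2) w"
    using normal_moment_even[of "sqrt w" 0 1] assms(2) by (simp add: fact_numeral)
  have "has_bochner_integral lborel
      (\<lambda>x. (1 / v - 1 / w) / 2 * (normal_density 0 (sqrt w) x * x\<^sup>2)
        - ln (w / v) / 2 * normal_density 0 (sqrt w) x)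
      ((1 / v - 1 / w) / 2 * w - ln (w / v) / 2 * 1)"
    using assms(2)
    by (intro has_bochner_integral_diff has_bochner_integral_mult_right second)
       (simp_all add: has_bochner_integral_iff)
  moreover have "(1 / v - 1 / w) / 2 * w - ln (w / v) / 2 * 1 = (w / v - 1 - ln (w / v)) / 2"
    using assms by (simp add: field_simps)
  moreover have "(1 / v - 1 / w) / 2 * (normal_density 0 (sqrt w) x * x\<^sup>2)
        - ln (w / v) / 2 * normal_density 0 (sqrt w) x = normal_density 0 (sqrt w) x * ln (f x)" for x
    unfolding f_def using assms(1,2) by (simp add: ln_normal_density_ratio algebra_simps)
  ultimately have *: "has_bochner_integral lborel
      (\<lambda>x. normal_density 0 (sqrt w) x * ln (f x)) ((w / v - 1 - ln (w / v)) / 2)"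
    by (simp only:)
  show ?int
    using * by (simp add: integrable_density has_bochner_integral_iff)
  show ?val
    using * by (simp add: integral_density has_bochner_integral_iff)
qed

text \<open>Writing \<open>?N w\<close> as a density over \<open>?N v\<close> exhibits absolute
  continuity, so the value is a genuine divergence and not the default 0.\<close>

lemma relative_entropy_gaussian_vec:
  assumes "0 < v" "0 < w"
  shows "relative_entropy (gaussian_vec n w) (gaussian_vec n v)
    = real n / 2 * (w / v - 1 - ln (w / v))"
proof -
  let ?N = "\<lambda>u. density lborel (\<lambda>x. ennreal (normal_density 0 (sqrt u) x))"
  define f where "f = (\<lambda>x. normal_density 0 (sqrt w) x / normal_density 0 (sqrt v) x)"
  have N: "prob_space (?N u)" if "0 < u" for u
    using that by (intro prob_space_normal_density) simp
  have f [measurable]: "f \<in> borel_measurable borel" and pos: "\<And>x. 0 < f x"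
    using assms by (auto simp: f_def normal_density_pos)
  have dens: "density (?N v) (\<lambda>x. ennreal (f x)) = ?N w"
    unfolding f_def by (rule gaussian_density_ratio[OF assms])
  have log_ln: "log (exp 1) y = ln y" for y :: real
    by (simp add: log_def)
  have "KL_divergence (exp 1) (PiM {..<n} (\<lambda>_. ?N v)) (PiM {..<n} (\<lambda>_. density (?N v) (\<lambda>x. ennreal (f x))))
      = (\<Sum>i<n. KL_divergence (exp 1) (?N v) (density (?N v) (\<lambda>x. ennreal (f x))))"
    using pos integrable_ln_gaussian_ratio[OF assms] N assms
    by (intro KL_divergence_PiM_density)
       (simp_all add: dens log_ln prob_space_imp_sigma_finite, simp_all add: f_def)
  also have "\<dots> = real n * (\<integral>x. ln (f x) \<partial>?N w)"
    using pos N[OF assms(1)]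
    by (subst KL_density_eq_integral)
       (auto simp: dens log_ln prob_space_imp_sigma_finite less_imp_le)
  also have "\<dots> = real n / 2 * (w / v - 1 - ln (w / v))"
    unfolding f_def by (simp add: integral_ln_gaussian_ratio[OF assms])
  finally show ?thesis
    by (simp add: relative_entropy_def gaussian_vec_def dens)
qed

text \<open>\<open>R1\<close> and \<open>K1\<close> are indexed by the covert variance, since its
  value \<sigma>0^2 \<rho> n is fixed only after solving for \<rho>. By uniqueness, the sequences
  \<rho> quantified over can differ only at n = 0, which does not affect the asymptotics.\<close>

theorem lemma3:
  fixes \<Omega> :: "'w measure" and MSide :: "'s measure" and S :: "'w \<Rightarrow> 's" and S_adm :: "'s set"
    and \<sigma>0 :: real
    and R0 :: "nat \<Rightarrow> 'w \<Rightarrow> nat \<Rightarrow> real" and K0 :: "nat \<Rightarrow> 's \<Rightarrow> (nat \<Rightarrow> real) measure"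
    and R1 :: "nat \<Rightarrow> real \<Rightarrow> 'w \<Rightarrow> nat \<Rightarrow> real" and K1 :: "nat \<Rightarrow> real \<Rightarrow> 's \<Rightarrow> (nat \<Rightarrow> real) measure"
  assumes "\<sigma>0\<^sup>2 > 0"
    and "prob_space \<Omega>"
    and "S_adm \<subseteq> space MSide"
    and "\<And>n. n \<ge> 1 \<Longrightarrow> cond_law \<Omega> MSide S (vec_borel n) (R0 n) (K0 n)"
    and "\<And>n P. n \<ge> 1 \<Longrightarrow> P > 0 \<Longrightarrow> cond_law \<Omega> MSide S (vec_borel n) (R1 n P) (K1 n P)"
    and "\<And>n s. n \<ge> 1 \<Longrightarrow> s \<in> S_adm \<Longrightarrow> K0 n s = gaussian_vec n (\<sigma>0\<^sup>2)"
    and "\<And>n P s. n \<ge> 1 \<Longrightarrow> P > 0 \<Longrightarrow> s \<in> S_adm \<Longrightarrow> K1 n P s = gaussian_vec n (\<sigma>0\<^sup>2 + P)"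
  shows "\<forall>\<delta>::real. \<delta> > 0 \<longrightarrow>
    (\<forall>n::nat. n \<ge> 1 \<longrightarrow> (\<exists>!\<rho>::real. \<rho> > 0 \<and> real n / 2 * (\<rho> - ln (1 + \<rho>)) = \<delta>)) \<and>
    (\<forall>\<rho>::nat \<Rightarrow> real.
       (\<forall>n\<ge>1. \<rho> n > 0 \<and> real n / 2 * (\<rho> n - ln (1 + \<rho> n)) = \<delta>) \<longrightarrow>
         (\<forall>n\<ge>1. \<forall>s\<in>S_adm. relative_entropy (K1 n (\<sigma>0\<^sup>2 * \<rho> n) s) (K0 n s) = \<delta>) \<and>
         (\<lambda>n. \<rho> n - 2 * sqrt (\<delta> / real n)) \<in> O(\<lambda>n. \<delta> / real n))"
proof (intro allI impI conjI)
  fix \<delta> :: real and n :: nat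
  assume "\<delta> > 0" "n \<ge> 1"
  then have "real n / 2 * (x - ln (1 + x)) = \<delta> \<longleftrightarrow> x - ln (1 + x) = 2 * \<delta> / real n" for x
    by (auto simp: field_simps)
  then show "\<exists>!\<rho>::real. \<rho> > 0 \<and> real n / 2 * (\<rho> - ln (1 + \<rho>)) = \<delta>"
    using ex1_diff_ln_eq[of "2 * \<delta> / real n"] \<open>\<delta> > 0\<close> \<open>n \<ge> 1\<close> by simp
next
  fix \<delta> :: real and \<rho> :: "nat \<Rightarrow> real"
  assume \<delta>: "\<delta> > 0" and \<rho>: "\<forall>n\<ge>1. \<rho> n > 0 \<and> real n / 2 * (\<rho> n - ln (1 + \<rho> n)) = \<delta>"
  show "\<forall>s\<in>S_adm. relative_entropy (K1 n (\<sigma>0\<^sup>2 * \<rho> n) s) (K0 n s) = \<delta>" if n: "n \<ge> 1" for n :: nat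
  proof
    fix s assume s: "s \<in> S_adm"
    have pos: "\<sigma>0\<^sup>2 * \<rho> n > 0" using assms(1) \<rho> n by simp
    have "relative_entropy (K1 n (\<sigma>0\<^sup>2 * \<rho> n) s) (K0 n s)
        = relative_entropy (gaussian_vec n (\<sigma>0\<^sup>2 + \<sigma>0\<^sup>2 * \<rho> n)) (gaussian_vec n (\<sigma>0\<^sup>2))"
      using assms(6)[OF n s] assms(7)[OF n pos s] by simp
    also have "\<dots> = real n / 2 * ((\<sigma>0\<^sup>2 + \<sigma>0\<^sup>2 * \<rho> n) / \<sigma>0\<^sup>2 - 1 - ln ((\<sigma>0\<^sup>2 + \<sigma>0\<^sup>2 * \<rho> n) / \<sigma>0\<^sup>2))"
      using assms(1) pos by (intro relative_entropy_gaussian_vec add_pos_pos)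
    also have "(\<sigma>0\<^sup>2 + \<sigma>0\<^sup>2 * \<rho> n) / \<sigma>0\<^sup>2 = 1 + \<rho> n"
      using assms(1) by (simp add: field_simps)
    finally show "relative_entropy (K1 n (\<sigma>0\<^sup>2 * \<rho> n) s) (K0 n s) = \<delta>"
      using \<rho> n by simp
  qed
  show "(\<lambda>n. \<rho> n - 2 * sqrt (\<delta> / real n)) \<in> O(\<lambda>n. \<delta> / real n)"
  \<comment> \<open>The gap between \<rho> n and sqrt (2a) lies in [0, 2a] with a = 2 \<delta> / n,
    hence the constant 4.\<close>
  proof (rule bigoI[of _ 4], rule eventually_mono[OF eventually_ge_at_top[of 1]])
    fix n :: nat assume n: "1 \<le> n"
    have a: "\<rho> n - ln (1 + \<rho> n) = 2 * (\<delta> / real n)"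
      using \<rho> n by (auto simp: field_simps)
    have "sqrt (2 * (2 * (\<delta> / real n))) = 2 * sqrt (\<delta> / real n)"
      using real_sqrt_mult[of 4 "\<delta> / real n"] by simp
    then have "2 * sqrt (\<delta> / real n) \<le> \<rho> n" "\<rho> n \<le> 2 * sqrt (\<delta> / real n) + 4 * (\<delta> / real n)"
      using diff_ln_solution_bounds[of "\<rho> n"] \<rho> n unfolding a by auto
    then show "norm (\<rho> n - 2 * sqrt (\<delta> / real n)) \<le> 4 * norm (\<delta> / real n)"
      using \<delta> by simp
  qed
qed

end
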